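(* Let $\Delta\subset\mathbb{R}^n$ be a nondegenerate $n$-simplex with faces $F_0,\dots,F_n$ and normalized outward normals $\mathbf{k}_0,\dots,\mathbf{k}_n$, and let $\mathcal{P}=\{p_0,\dots,p_n\}$ be a contact set with $p_i$ in the relative interior of $F_i$ for each $i$. Then $\mathcal{P}$ immobilizes $\Delta$ if and only if the function $\Phi: SO(n)\to\mathbb{R}$, $\Phi(r)=\sum_{i=0}^n (r(p_i)-p_i)\cdot \mathbf{k}_i$, has a strict local maximum at the identity $I$.
   Context: $\Delta$ has vertices $v_0,\dots,v_n$, ordered so that $\mathrm{vol}(\Delta)=\frac{1}{n!}\det[v_1-v_0,\dots,v_n-v_0]>0$. $F_i$ is the $(n-1)$-dimensional face of $\Delta$ opposite $v_i$ (with vertices $v_j$, $j\ne i$). $\mathbf{k}_i$ is the outward pointing normal to $F_i$ with $|\mathbf{k}_i|=\mathrm{vol}(F_i)$, the $(n-1)$-dimensional volume of $F_i$; with this normalization $\sum_{i=0}^n\mathbf{k}_i=\mathbf{0}$, and any $n$ of the $\mathbf{k}_i$ are linearly independent. $\mathbb{E}_n$ is the group of (orientation preserving) rigid motions $x\mapsto Rx+\underline{a}$ of $\mathbb{R}^n$, $R\in SO(n)$, $\underline{a}\in\mathbb{R}^n$, with its usual topology. The contact set $\mathcal{P}$ immobilizes $\Delta$ if there is a neighbourhood $N$ of the identity in $\mathbb{E}_n$ such that for every $g\in N$, $g\neq I$, at least one point $p_i$ penetrates $\Delta$ under $g$, i.e. $g(p_i)$ lies in the interior of $\Delta$ (for $g$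 near $I$ this is equivalent to $(g(p_i)-p_i)\cdot\mathbf{k}_i<0$). $\Phi$ has a strict local maximum at $I$ if $\Phi(r)<\Phi(I)=0$ for all $r\ne I$ in some neighbourhood of $I$ in $SO(n)$. *)

theory Defs
  imports "HOL-Analysis.Analysis"
begin

text \<open>
  A simplex in \<open>real^'n\<close> is given by its \<open>CARD('n) + 1\<close> vertices
  \<open>v :: 'n option \<Rightarrow> real^'n\<close>, where \<open>v None\<close> is the vertex \<open>v\<^sub>0\<close> and \<open>v (Some j)\<close>, for \<open>j :: 'n\<close>,
  are the vertices \<open>v\<^sub>1, \<dots>, v\<^sub>n\<close>.  Numbering the type \<open>'n\<close> numbers the coordinates and the vertices
  simultaneously, so the determinant below does not depend on the numbering.
\<close>

definition simplex_hull :: "('n::finite option \<Rightarrow> real^'n) \<Rightarrow> (real^'n) set" where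
  "simplex_hull v = convex hull (range v)"

definition simplex_face :: "('n::finite option \<Rightarrow> real^'n) \<Rightarrow> 'n option \<Rightarrow> (real^'n) set" where
  "simplex_face v i = convex hull (v ` (- {i}))"

text \<open>Row \<open>r\<close>, column \<open>c\<close>: the columns of the matrix are the edge vectors from \<open>v\<^sub>0\<close>.\<close>

definition simplex_volume :: "('n::finite option \<Rightarrow> real^'n) \<Rightarrow> real" where
  "simplex_volume v =
     (1 / fact CARD('n)) * det ((\<chi> r c. (v (Some c) - v None) $ r) :: real^'n^'n)"

definition orthonormal_frame :: "nat \<Rightarrow> (nat \<Rightarrow> 'a::euclidean_space) \<Rightarrow> bool" where
  "orthonormal_frame d e \<longleftrightarrow> (\<forall>i<d. \<forall>j<d. e i \<bullet> e j = (if i = j then 1 else 0))"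

text \<open>
  The \<open>d\<close>-dimensional volume of a set \<open>S\<close> contained in a \<open>d\<close>-dimensional affine subspace: the
  \<open>d\<close>-dimensional Lebesgue measure of \<open>S\<close> in Cartesian coordinates on that subspace.  Any two
  Cartesian coordinate systems differ by a rigid motion of the coordinate space, so for the compact
  sets \<open>S\<close> considered here the value does not depend on the choice made by \<open>SOME\<close>.
  For \<open>d = 0\<close> a point has volume 1.
\<close>

definition flat_volume :: "nat \<Rightarrow> 'a::euclidean_space set \<Rightarrow> real" where
  "flat_volume d S = (SOME m. \<exists>a e. orthonormal_frame d e \<and>
     S \<subseteq> range (\<lambda>x. a + (\<Sum>j<d. x j *\<^sub>R e j)) \<and>
     m = measure (\<Pi>\<^sub>M j\<in>{..<d}. lborel)
           {x \<in> {..<d} \<rightarrow>\<^sub>E UNIV. a + (\<Sum>j<d. x j *\<^sub>R e j) \<in> S})"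

definition outward_face_normal ::
    "('n::finite option \<Rightarrow> real^'n) \<Rightarrow> 'n option \<Rightarrow> real^'n \<Rightarrow> bool" where
  "outward_face_normal v i k \<longleftrightarrow>
     (\<forall>x\<in>simplex_face v i. \<forall>y\<in>simplex_face v i. k \<bullet> (x - y) = 0) \<and>
     (\<forall>x\<in>simplex_face v i. k \<bullet> (v i - x) < 0) \<and>
     norm k = flat_volume (CARD('n) - 1) (simplex_face v i)"

definition SO :: "(real^'n::finite^'n) set" where
  "SO = {R. rotation_matrix R}"

text \<open>
  The rigid motion \<open>x \<mapsto> R x + a\<close> is represented by the pair \<open>(R, a)\<close>.  The representation is
  unique, and the usual topology is the one induced by the product topology on pairs.
\<close>

definition rigid_motions :: "((real^'n::finite^'n) \<times> (real^'n)) set" where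
  "rigid_motions = SO \<times> UNIV"

definition rigid_id :: "(real^'n::finite^'n) \<times> (real^'n)" where
  "rigid_id = (mat 1, 0)"

definition rigid_apply :: "(real^'n::finite^'n) \<times> (real^'n) \<Rightarrow> real^'n \<Rightarrow> real^'n" where
  "rigid_apply g x = fst g *v x + snd g"

definition immobilizes ::
    "('n::finite option \<Rightarrow> real^'n) \<Rightarrow> ('n option \<Rightarrow> real^'n) \<Rightarrow> bool" where
  "immobilizes p v \<longleftrightarrow>
     (\<exists>N. openin (top_of_set rigid_motions) N \<and> rigid_id \<in> N \<and>
        (\<forall>g\<in>N. g \<noteq> rigid_id \<longrightarrow> (\<exists>i. rigid_apply g (p i) \<in> interior (simplex_hull v))))"

definition strict_local_max_on ::
    "'a::topological_space set \<Rightarrow> ('a \<Rightarrow> real) \<Rightarrow> 'a \<Rightarrow> bool" where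
  "strict_local_max_on S f x \<longleftrightarrow>
     (\<exists>U. openin (top_of_set S) U \<and> x \<in> U \<and> (\<forall>r\<in>U. r \<noteq> x \<longrightarrow> f r < f x))"

definition contact_Phi ::
    "('n::finite option \<Rightarrow> real^'n) \<Rightarrow> ('n option \<Rightarrow> real^'n) \<Rightarrow> real^'n^'n \<Rightarrow> real" where
  "contact_Phi p k r = (\<Sum>i\<in>UNIV. (r *v p i - p i) \<bullet> k i)"

end

theory Submission
  imports Defs
begin

text \<open>
  Let \<open>\<lambda>\<^sub>i\<close> be the barycentric coordinates of the simplex; they are affine functions with sum \<open>1\<close>.
  The outward normal \<open>k i\<close> is a negative multiple of the gradient \<open>g i\<close> of \<open>\<lambda>\<^sub>i\<close>, and the
  normalization by the volume of the face makes the factor \<open>- V\<close> the same for all faces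
  (\<open>outward_normals_eq_gradients\<close>); in particular the normals add up to \<open>0\<close>.  As \<open>\<lambda>\<^sub>i\<close> vanishes at
  \<open>p i\<close>, it follows that, for every rotation \<open>r\<close> and every translation vector \<open>a\<close>,
  \<open>\<Phi> r = - V * (\<Sum>i. \<lambda>\<^sub>i (r (p i) + a))\<close>, a value that does not depend on \<open>a\<close>
  (\<open>contact_Phi_eq_sum_coord\<close>).

  The interior of the simplex is the set where all \<open>\<lambda>\<^sub>j\<close> are positive, and near the identity
  \<open>\<lambda>\<^sub>j (r (p i) + a)\<close> stays positive for \<open>j \<noteq> i\<close>.  Hence a small motion makes \<open>p i\<close> penetrate exactly
  if \<open>\<lambda>\<^sub>i (r (p i) + a) > 0\<close>.  If \<open>\<Phi> r < 0\<close>, these \<open>n + 1\<close> numbers have a positive sum, so one of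
  them is positive; for \<open>r = I\<close> their sum is \<open>0\<close>, and they do not all vanish unless \<open>a = 0\<close>, because
  the gradients span the space.  Conversely, a translation can change the \<open>n + 1\<close> numbers by any
  amounts of sum \<open>0\<close> (\<open>inner_gradient_combination\<close>), and it is small if these are small.  It can
  therefore make all the numbers equal to their mean, which is \<open>\<le> 0\<close> if \<open>\<Phi> r \<ge> 0\<close>; then no point
  penetrates.

  The remaining work is the common factor \<open>V\<close>, that is, the formula
  \<open>vol (F\<^sub>i) = V * norm (g i)\<close> (\<open>flat_volume_face_proportional\<close>).  The volume of a face is read off
  from a slab: the prism over \<open>F\<^sub>i\<close> with height \<open>1 / norm (g i)\<close> has \<open>n\<close>-dimensional volume
  \<open>vol (F\<^sub>i) / norm (g i)\<close> by Fubini's theorem.  A reflection fixing the hyperplane of \<open>F\<^sub>i\<close> shows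
  that this is also the volume of the oblique slab over \<open>F\<^sub>i\<close> in the direction of an edge
  \<open>v i - v j\<close>, and the affine involution that exchanges \<open>v i\<close> and \<open>v j\<close> maps that slab to the
  corresponding one over \<open>F\<^sub>j\<close>.  Affine involutions preserve Lebesgue measure, so the number
  is the same for all faces.
\<close>

section \<open>Linear maps and Lebesgue measure\<close>

text \<open>
  It is enough to know that \<open>f\<close> scales volumes by some factor; for the maps needed below
  the factor is then seen to be \<open>1\<close> without computing a determinant.  The property passes to
  compositions, so it has to be checked for elementary maps only.
\<close>
lemma linear_image_scales_lebesgue:
  fixes f :: "real^'n \<Rightarrow> real^'n"
  assumes "linear f"
  shows "\<exists>c. \<forall>S\<in>lmeasurable. f ` S \<in> lmeasurable \<and> measure lebesgue (f ` S) = c * measure lebesgue S"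
  using assms
proof (rule induct_linear_elementary)
  fix f g :: "real^'n \<Rightarrow> real^'n"
  assume "\<exists>c. \<forall>S\<in>lmeasurable. f ` S \<in> lmeasurable \<and> measure lebesgue (f ` S) = c * measure lebesgue S"
    and "\<exists>c. \<forall>S\<in>lmeasurable. g ` S \<in> lmeasurable \<and> measure lebesgue (g ` S) = c * measure lebesgue S"
  then obtain c d where
    "\<forall>S\<in>lmeasurable. f ` S \<in> lmeasurable \<and> measure lebesgue (f ` S) = c * measure lebesgue S"
    "\<forall>S\<in>lmeasurable. g ` S \<in> lmeasurable \<and> measure lebesgue (g ` S) = d * measure lebesgue S"
    by blast
  then have "\<forall>S\<in>lmeasurable. f ` g ` S \<in> lmeasurable \<and>
      measure lebesgue (f ` g ` S) = (c * d) * measure lebesgue S"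
    by simp
  then have "\<forall>S\<in>lmeasurable. (f \<circ> g) ` S \<in> lmeasurable \<and>
      measure lebesgue ((f \<circ> g) ` S) = (c * d) * measure lebesgue S"
    unfolding image_comp .
  then show "\<exists>c. \<forall>S\<in>lmeasurable. (f \<circ> g) ` S \<in> lmeasurable \<and>
      measure lebesgue ((f \<circ> g) ` S) = c * measure lebesgue S"
    by blast
next
  fix f :: "real^'n \<Rightarrow> real^'n" and i
  assume "linear f" and "\<And>x. f x $ i = 0"
  have "negligible (f ` S)" for S
    by (rule negligible_subset [OF negligible_standard_hyperplane_cart [of i]])
       (auto simp: \<open>\<And>x. f x $ i = 0\<close>)
  then show "\<exists>c. \<forall>S\<in>lmeasurable. f ` S \<in> lmeasurable \<and> measure lebesgue (f ` S) = c * measure lebesgue S"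
    by (intro exI [of _ 0]) (auto simp: negligible_iff_measure)
next
  fix m :: "'n \<Rightarrow> real"
  show "\<exists>c. \<forall>S\<in>lmeasurable. (\<lambda>x. \<chi> i. m i * x $ i) ` S \<in> lmeasurable \<and>
      measure lebesgue ((\<lambda>x. \<chi> i. m i * x $ i) ` S) = c * measure lebesgue S"
    using measurable_stretch measure_stretch by blast
next
  fix m n :: 'n
  let ?t = "\<lambda>x::real^'n. \<chi> i. x $ Transposition.transpose m n i"
  have lin: "linear ?t"
    by (rule linearI) (auto simp: vec_eq_iff)
  have "measure lebesgue (?t ` cbox a b) = 1 * measure lebesgue (cbox a b)" for a b
  proof -
    have "x \<in> ?t ` cbox a b" if "x \<in> cbox (?t a) (?t b)" for x
    proof (rule image_eqI)
      show "x = ?t (?t x)"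
        by (simp add: vec_eq_iff)
      show "?t x \<in> cbox a b"
        using that by (auto simp: mem_box_cart) (metis transpose_involutory)+
    qed
    then have img: "?t ` cbox a b = cbox (?t a) (?t b)"
      by (auto simp: mem_box_cart)
    have "(\<Prod>i\<in>UNIV. ?t b $ i - ?t a $ i) = (\<Prod>i\<in>UNIV. b $ i - a $ i)"
      by (rule prod.reindex_bij_witness
            [of _ "Transposition.transpose m n" "Transposition.transpose m n"]) auto
    moreover have "cbox (?t a) (?t b) = {} \<longleftrightarrow> cbox a b = {}"
      using img by auto
    ultimately show ?thesis
      by (simp add: img content_cbox_if_cart)
  qed
  then have "?t ` S \<in> lmeasurable \<and> measure lebesgue (?t ` S) = 1 * measure lebesgue S"
    if "S \<in> lmeasurable" for S
    using measure_linear_sufficient [OF lin that] by metis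
  then show "\<exists>c. \<forall>S\<in>lmeasurable. ?t ` S \<in> lmeasurable \<and>
      measure lebesgue (?t ` S) = c * measure lebesgue S"
    by blast
next
  fix m n :: 'n
  assume "m \<noteq> n"
  let ?h = "\<lambda>x::real^'n. \<chi> i. if i = m then x $ m + x $ n else x $ i"
  have lin: "linear ?h"
    by (rule linearI) (auto simp: vec_eq_iff algebra_simps)
  have "measure lebesgue (?h ` cbox a b) = 1 * measure lebesgue (cbox a b)" for a b
  proof (cases "cbox a b = {}")
    case False
    define s where "s = (\<chi> i. if i = n then - a $ n else (0::real))"
    have "measure lebesgue (?h ` cbox a b) = measure lebesgue ((+) (?h s) ` ?h ` cbox a b)"
      by (simp add: measure_translation)
    also have "(+) (?h s) ` ?h ` cbox a b = ?h ` (+) s ` cbox a b"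
      by (simp add: image_image linear_add [OF lin])
    also have "\<dots> = ?h ` cbox (s + a) (s + b)"
      by (simp add: cbox_translation)
    also have "measure lebesgue \<dots> = measure lebesgue (cbox (s + a) (s + b))"
      by (rule measure_shear_interval [OF \<open>m \<noteq> n\<close>])
         (use False in \<open>auto simp: s_def cbox_translation\<close>)
    also have "\<dots> = measure lebesgue ((+) s ` cbox a b)"
      by (simp only: cbox_translation)
    also have "\<dots> = measure lebesgue (cbox a b)"
      by (rule measure_translation)
    finally show ?thesis by simp
  qed simp
  then have "?h ` S \<in> lmeasurable \<and> measure lebesgue (?h ` S) = 1 * measure lebesgue S"
    if "S \<in> lmeasurable" for S
    using measure_linear_sufficient [OF lin that] by metis
  then show "\<exists>c. \<forall>S\<in>lmeasurable. ?h ` S \<in> lmeasurable \<and>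
      measure lebesgue (?h ` S) = c * measure lebesgue S"
    by blast
qed

text \<open>The scaling factor \<open>c\<close> satisfies \<open>c * c = 1\<close>.\<close>

lemma measure_linear_involution_image:
  fixes f :: "real^'n \<Rightarrow> real^'n"
  assumes "linear f" and inv: "\<And>x. f (f x) = x" and "S \<in> lmeasurable"
  shows "measure lebesgue (f ` S) = measure lebesgue S"
proof -
  obtain c where c: "\<And>S. S \<in> lmeasurable \<Longrightarrow> f ` S \<in> lmeasurable"
      "\<And>S. S \<in> lmeasurable \<Longrightarrow> measure lebesgue (f ` S) = c * measure lebesgue S"
    using linear_image_scales_lebesgue [OF \<open>linear f\<close>] by blast
  have "measure lebesgue (f ` f ` ball 0 1) = c * (c * measure lebesgue (ball (0::real^'n) 1))"
    by (simp add: c)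
  moreover have "measure lebesgue (ball (0::real^'n) 1) > 0"
    by (simp add: content_ball_pos)
  ultimately have "c * c = 1"
    by (simp add: image_image inv)
  moreover have "c \<ge> 0"
    using c(2) [of "ball 0 1"] \<open>measure lebesgue (ball (0::real^'n) 1) > 0\<close>
    by (metis lmeasurable_ball measure_nonneg mult_less_0_iff not_less)
  ultimately have "c = 1"
    by (metis abs_of_nonneg abs_square_eq_1 power2_eq_square)
  with c assms(3) show ?thesis
    by simp
qed

text \<open>The scaling factor is \<open>1\<close> because the unit ball is mapped onto itself.\<close>

lemma measure_orthogonal_transformation_image:
  fixes f :: "real^'n \<Rightarrow> real^'n"
  assumes f: "orthogonal_transformation f" and "S \<in> lmeasurable"
  shows "measure lebesgue (f ` S) = measure lebesgue S"
proof -
  obtain c where c: "\<And>S. S \<in> lmeasurable \<Longrightarrow> measure lebesgue (f ` S) = c * measure lebesgue S"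
    using linear_image_scales_lebesgue [OF orthogonal_transformation_linear [OF f]] by blast
  have "c * measure lebesgue (ball (0::real^'n) 1) = measure lebesgue (ball (0::real^'n) 1)"
    using c [of "ball 0 1"] f
    by (simp add: image_orthogonal_transformation_ball linear_0 orthogonal_transformation_linear)
  moreover have "measure lebesgue (ball (0::real^'n) 1) > 0"
    by (simp add: content_ball_pos)
  ultimately have "c = 1" by simp
  with c assms(2) show ?thesis by simp
qed

section \<open>Volume in Cartesian coordinates\<close>

text \<open>
  An orthonormal frame differs from a numbering of the standard basis by an orthogonal map and
  a translation.  For the standard basis, the product measure agrees with \<open>lborel\<close> on boxes.
\<close>

lemma emeasure_frame_coordinates:
  fixes e :: "nat \<Rightarrow> real^'n"
  assumes e: "orthonormal_frame CARD('n) e" and S: "compact S"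
  shows "emeasure (\<Pi>\<^sub>M j\<in>{..<CARD('n)}. lborel)
           {x \<in> {..<CARD('n)} \<rightarrow>\<^sub>E UNIV. a + (\<Sum>j<CARD('n). x j *\<^sub>R e j) \<in> S} = ennreal (measure lebesgue S)"
proof -
  let ?n = "CARD('n)"
  let ?P = "\<Pi>\<^sub>M j\<in>{..<?n}. (lborel :: real measure)"
  interpret P: product_sigma_finite "\<lambda>_::nat. lborel :: real measure" ..
  obtain h :: "nat \<Rightarrow> 'n" where h: "bij_betw h {..<?n} UNIV"
    using ex_bij_betw_nat_finite [of "UNIV :: 'n set"] by (auto simp: atLeast0LessThan)
  define k where "k = the_inv_into {..<?n} h"
  have k: "k i < ?n" "h (k i) = i" for i
    using h unfolding k_def
    by (auto simp: bij_betw_def f_the_inv_into_f dest: the_inv_into_into [of h "{..<?n}" i])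
  have kh: "k (h j) = j" if "j < ?n" for j
    using h that unfolding k_def by (simp add: bij_betw_def the_inv_into_f_f)
  have reindex: "(\<Sum>i\<in>UNIV. F (k i)) = (\<Sum>j<?n. F j)" for F :: "nat \<Rightarrow> 'b::comm_monoid_add"
    by (rule sum.reindex_bij_witness [of _ h k]) (auto simp: k kh)
  have reindexp: "(\<Prod>i\<in>UNIV. F (k i)) = (\<Prod>j<?n. F j)" for F :: "nat \<Rightarrow> 'b::comm_monoid_mult"
    by (rule prod.reindex_bij_witness [of _ h k]) (auto simp: k kh)
  have all_index: "(\<forall>i. Q (k i) i) \<longleftrightarrow> (\<forall>j<?n. Q j (h j))" for Q :: "nat \<Rightarrow> 'n \<Rightarrow> bool"
    using k kh by metis
  define \<phi> where "\<phi> x = (\<chi> i. x (k i))" for x :: "nat \<Rightarrow> real"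
  have \<phi>[measurable]: "\<phi> \<in> ?P \<rightarrow>\<^sub>M borel"
  proof -
    have "(\<lambda>x. \<Sum>i\<in>UNIV. x (k i) *\<^sub>R axis i (1::real)) \<in> ?P \<rightarrow>\<^sub>M borel"
      using k by (intro borel_measurable_sum borel_measurable_scaleR) auto
    moreover have "\<phi> = (\<lambda>x. \<Sum>i\<in>UNIV. x (k i) *\<^sub>R axis i (1::real))"
      by (rule ext) (simp add: \<phi>_def vec_eq_iff axis_def if_distrib cong: if_cong)
    ultimately show ?thesis
      by simp
  qed
  \<comment> \<open>\<open>\<phi>\<close> parametrizes the space by the standard coordinates, numbered by \<open>h\<close>; the orthogonal map
      \<open>T\<close> below turns the standard basis into the frame \<open>e\<close>.\<close>
  have lborel_eq_distr: "lborel = distr ?P borel \<phi>"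
  proof (rule lborel_eqI)
    fix l u :: "real^'n"
    assume le: "\<And>b. b \<in> Basis \<Longrightarrow> l \<bullet> b \<le> u \<bullet> b"
    have le: "l $ i \<le> u $ i" for i
      using le [of "axis i 1"] by (simp add: inner_axis)
    have "emeasure (distr ?P borel \<phi>) (box l u) = emeasure ?P (\<phi> -` box l u \<inter> space ?P)"
      by (simp add: emeasure_distr)
    also have "\<phi> -` box l u \<inter> space ?P = (\<Pi>\<^sub>E j\<in>{..<?n}. {l $ h j <..< u $ h j})"
    proof (rule set_eqI)
      fix x :: "nat \<Rightarrow> real"
      have "x \<in> \<phi> -` box l u \<inter> space ?P \<longleftrightarrow>
          x \<in> {..<?n} \<rightarrow>\<^sub>E UNIV \<and> (\<forall>i. l $ i < x (k i) \<and> x (k i) < u $ i)"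
        by (simp add: \<phi>_def mem_box_cart space_PiM conj_commute)
      also have "\<dots> \<longleftrightarrow> x \<in> {..<?n} \<rightarrow>\<^sub>E UNIV \<and> (\<forall>j<?n. l $ h j < x j \<and> x j < u $ h j)"
        using all_index [of "\<lambda>j i. l $ i < x j \<and> x j < u $ i"] by simp
      also have "\<dots> \<longleftrightarrow> x \<in> (\<Pi>\<^sub>E j\<in>{..<?n}. {l $ h j <..< u $ h j})"
        by (auto simp: PiE_iff)
      finally show "x \<in> \<phi> -` box l u \<inter> space ?P \<longleftrightarrow> x \<in> (\<Pi>\<^sub>E j\<in>{..<?n}. {l $ h j <..< u $ h j})" .
    qed
    also have "emeasure ?P \<dots> = (\<Prod>j<?n. emeasure lborel {l $ h j <..< u $ h j})"
      by (rule P.emeasure_PiM) auto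
    also have "\<dots> = (\<Prod>j<?n. ennreal (u $ h j - l $ h j))"
      using le by simp
    also have "\<dots> = (\<Prod>i\<in>UNIV. ennreal (u $ i - l $ i))"
      using reindexp [of "\<lambda>j. ennreal (u $ h j - l $ h j)"] by (simp add: k)
    also have "\<dots> = ennreal (\<Prod>i\<in>UNIV. (u $ i - l $ i))"
      using le by (simp add: prod_ennreal)
    also have "(\<Prod>i\<in>UNIV. (u $ i - l $ i)) = (\<Prod>b\<in>Basis. (u - l) \<bullet> b)"
    proof -
      have "(Basis :: (real^'n) set) = range (\<lambda>i. axis i 1)"
        by (auto simp: Basis_vec_def)
      moreover have "inj (\<lambda>i::'n. axis i (1::real))"
        by (auto simp: inj_def axis_eq_axis)
      ultimately have "(\<Prod>b\<in>Basis. (u - l) \<bullet> b) = (\<Prod>i\<in>UNIV. (u - l) \<bullet> axis i 1)"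
        by (metis (no_types, lifting) prod.reindex_cong)
      then show ?thesis
        by (simp add: inner_axis)
    qed
    finally show "emeasure (distr ?P borel \<phi>) (box l u) = (\<Prod>b\<in>Basis. (u - l) \<bullet> b)" .
  qed simp
  define T where "T y = (\<Sum>i\<in>UNIV. (y $ i) *\<^sub>R e (k i))" for y :: "real^'n"
  have T: "orthogonal_transformation T"
    unfolding orthogonal_transformation_def
  proof (intro conjI allI)
    show "linear T"
      by (rule linearI) (simp_all add: T_def scaleR_left_distrib sum.distrib scaleR_sum_right)
    fix x y
    have ek: "e (k i) \<bullet> e (k j) = (if i = j then 1 else 0)" for i j
      using e k by (metis orthonormal_frame_def)
    have "T x \<bullet> T y = (\<Sum>i\<in>UNIV. x $ i * y $ i)"
      by (simp add: T_def inner_sum_left inner_sum_right ek if_distrib mult.commute cong: if_cong)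
    then show "T x \<bullet> T y = x \<bullet> y"
      by (simp add: inner_vec_def)
  qed
  have T\<phi>: "T (\<phi> x) = (\<Sum>j<?n. x j *\<^sub>R e j)" for x
    unfolding T_def \<phi>_def using reindex [of "\<lambda>j. x j *\<^sub>R e j"] by simp
  define S' where "S' = inv T ` (\<lambda>y. y - a) ` S"
  have "compact S'"
    unfolding S'_def using S orthogonal_transformation_inv [OF T]
    by (intro compact_continuous_image linear_continuous_on continuous_intros)
       (simp_all add: orthogonal_transformation_linear linear_conv_bounded_linear [symmetric])
  have mem: "a + T y \<in> S \<longleftrightarrow> y \<in> S'" for y
  proof
    assume "a + T y \<in> S"
    moreover have "y = inv T (a + T y - a)"
      by (simp add: orthogonal_transformation_inj [OF T])
    ultimately show "y \<in> S'"
      unfolding S'_def by blast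
  next
    assume "y \<in> S'"
    then show "a + T y \<in> S"
      by (auto simp: S'_def surj_f_inv_f [OF orthogonal_transformation_surj [OF T]])
  qed
  have "{x \<in> {..<?n} \<rightarrow>\<^sub>E UNIV. a + (\<Sum>j<?n. x j *\<^sub>R e j) \<in> S} = \<phi> -` S' \<inter> space ?P"
    by (auto simp: T\<phi> [symmetric] mem space_PiM)
  then have "emeasure ?P {x \<in> {..<?n} \<rightarrow>\<^sub>E UNIV. a + (\<Sum>j<?n. x j *\<^sub>R e j) \<in> S}
      = emeasure (distr ?P borel \<phi>) S'"
    using \<open>compact S'\<close> by (simp add: emeasure_distr borel_compact)
  also have "\<dots> = emeasure lebesgue S'"
    using \<open>compact S'\<close> by (simp add: lborel_eq_distr [symmetric] borel_compact)
  also have "\<dots> = ennreal (measure lebesgue S')"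
    by (rule emeasure_eq_measure2 [OF lmeasurable_compact [OF \<open>compact S'\<close>]])
  also have "measure lebesgue S' = measure lebesgue ((\<lambda>y. y - a) ` S)"
    unfolding S'_def using S
    by (intro measure_orthogonal_transformation_image orthogonal_transformation_inv T
          lmeasurable_compact compact_continuous_image continuous_intros)
  also have "\<dots> = measure lebesgue S"
    by (rule measure_translation_subtract)
  finally show ?thesis .
qed

section \<open>The volume of a flat set as the volume of a slab\<close>

definition slab :: "'a::real_vector set \<Rightarrow> 'a \<Rightarrow> 'a set" where
  "slab S w = (\<lambda>(y, t). y + t *\<^sub>R w) ` (S \<times> {0..1})"

lemma compact_slab: 
  fixes S :: "'a::real_normed_vector set"
  shows "compact S \<Longrightarrow> compact (slab S w)"
  unfolding slab_def
  by (intro compact_continuous_image compact_Times)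
     (auto simp: case_prod_beta intro!: continuous_intros)

text \<open>
  The frame extended by the normal \<open>u\<close> gives Cartesian coordinates of the whole space, in which the
  slab is the product of the coordinate region of \<open>S\<close> and the interval \<open>{0..h}\<close>.
\<close>

lemma measure_normal_slab:
  fixes e :: "nat \<Rightarrow> real^'n"
  assumes e: "orthonormal_frame (CARD('n) - 1) e" and norm: "norm u = 1"
    and perp: "\<And>j. j < CARD('n) - 1 \<Longrightarrow> e j \<bullet> u = 0"
    and S: "compact S" "S \<subseteq> range (\<lambda>x. a + (\<Sum>j<CARD('n)-1. x j *\<^sub>R e j))" and "h > 0"
  shows "measure lebesgue (slab S (h *\<^sub>R u)) =
    h * measure (\<Pi>\<^sub>M j\<in>{..<CARD('n)-1}. lborel)
          {x \<in> {..<CARD('n)-1} \<rightarrow>\<^sub>E UNIV. a + (\<Sum>j<CARD('n)-1. x j *\<^sub>R e j) \<in> S}"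
proof -
  define d where "d = CARD('n) - 1"
  have n: "CARD('n) = Suc d"
    using zero_less_card_finite[where 'a='n] by (simp add: d_def)
  let ?L = "\<lambda>_::nat. lborel :: real measure"
  interpret P: product_sigma_finite ?L ..
  define A where "A = {x \<in> {..<d} \<rightarrow>\<^sub>E UNIV. a + (\<Sum>j<d. x j *\<^sub>R e j) \<in> S}"
  define e' where "e' = e(d := u)"
  have e'_d: "e' d = u" and e'_less: "\<And>j. j < d \<Longrightarrow> e' j = e j"
    by (auto simp: e'_def)
  have "orthonormal_frame (Suc d) e'"
    unfolding orthonormal_frame_def
  proof (intro allI impI)
    fix i j assume "i < Suc d" "j < Suc d"
    moreover have "e i \<bullet> e j = (if i = j then 1 else 0)" if "i < d" "j < d"
      using e that by (simp add: orthonormal_frame_def d_def)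
    moreover have "u \<bullet> u = 1"
      using norm by (simp add: norm_eq_1)
    ultimately show "e' i \<bullet> e' j = (if i = j then 1 else 0)"
      using perp [folded d_def, of i] perp [folded d_def, of j] inner_commute [of u "e j"]
      by (cases "i = d"; cases "j = d") (simp_all add: less_Suc_eq e'_d e'_less)
  qed
  then have e': "orthonormal_frame CARD('n) e'"
    by (simp only: n)
  define B where "B = {x \<in> {..<Suc d} \<rightarrow>\<^sub>E UNIV. a + (\<Sum>j<Suc d. x j *\<^sub>R e' j) \<in> slab S (h *\<^sub>R u)}"
  have uS: "u \<bullet> y = u \<bullet> a" if "y \<in> S" for y
  proof -
    obtain x where "y = a + (\<Sum>j<d. x j *\<^sub>R e j)"
      using S(2) \<open>y \<in> S\<close> unfolding d_def by blast
    then show ?thesis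
      using perp by (simp add: inner_add_right inner_sum_right d_def inner_commute [of u])
  qed
  have mem: "x(d := t) \<in> B \<longleftrightarrow> x \<in> A \<and> t \<in> {0..h}" if x: "x \<in> {..<d} \<rightarrow>\<^sub>E UNIV" for x t
  proof -
    define z where "z = a + (\<Sum>j<d. x j *\<^sub>R e j)"
    have uz: "u \<bullet> z = u \<bullet> a"
      using perp by (simp add: z_def inner_add_right inner_sum_right d_def inner_commute [of u])
    have "x(d := t) \<in> B \<longleftrightarrow> z + t *\<^sub>R u \<in> slab S (h *\<^sub>R u)"
      using x by (auto simp: B_def z_def e'_d e'_less add.assoc PiE_iff extensional_def)
    also have "\<dots> \<longleftrightarrow> z \<in> S \<and> t \<in> {0..h}"
    proof
      assume "z + t *\<^sub>R u \<in> slab S (h *\<^sub>R u)"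
      then obtain y s where y: "y \<in> S" "0 \<le> s" "s \<le> 1" and eq: "z + t *\<^sub>R u = y + (s * h) *\<^sub>R u"
        by (auto simp: slab_def)
      have "u \<bullet> (z + t *\<^sub>R u) = u \<bullet> a + t" "u \<bullet> (y + (s * h) *\<^sub>R u) = u \<bullet> a + s * h"
        using uz uS [OF y(1)] norm by (simp_all add: inner_add_right norm_eq_1)
      with eq have "t = s * h"
        by simp
      with eq y \<open>h > 0\<close> show "z \<in> S \<and> t \<in> {0..h}"
        by (auto simp: mult_left_le_one_le)
    next
      assume "z \<in> S \<and> t \<in> {0..h}"
      with \<open>h > 0\<close> show "z + t *\<^sub>R u \<in> slab S (h *\<^sub>R u)"
        unfolding slab_def by (intro image_eqI [of _ _ "(z, t / h)"]) auto
    qed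
    also have "z \<in> S \<longleftrightarrow> x \<in> A"
      using x by (simp add: A_def z_def)
    finally show ?thesis .
  qed
  have coord: "(\<lambda>x. b + (\<Sum>j<m. x j *\<^sub>R f j)) \<in> PiM {..<m} ?L \<rightarrow>\<^sub>M borel"
    for m and b :: "real^'n" and f :: "nat \<Rightarrow> real^'n"
    by measurable
  have A: "A \<in> sets (PiM {..<d} ?L)"
    using measurable_sets [OF coord [where m = d and b = a and f = e] borel_compact [OF S(1)]]
    by (simp add: A_def space_PiM vimage_def Int_def conj_commute)
  have B: "B \<in> sets (PiM {..<Suc d} ?L)"
    using measurable_sets [OF coord [where m = "Suc d" and b = a and f = e']
        borel_compact [OF compact_slab [OF S(1), of "h *\<^sub>R u"]]]
    by (simp add: B_def space_PiM vimage_def Int_def conj_commute)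
  have "ennreal (measure lebesgue (slab S (h *\<^sub>R u))) = emeasure (PiM {..<Suc d} ?L) B"
    using emeasure_frame_coordinates [OF e' compact_slab [OF S(1)], of a "h *\<^sub>R u"]
    unfolding n B_def by simp
  also have "\<dots> = (\<integral>\<^sup>+ x. indicator B x \<partial>PiM (insert d {..<d}) ?L)"
    using B by (simp add: lessThan_Suc)
  also have "\<dots> = (\<integral>\<^sup>+ x. (\<integral>\<^sup>+ t. indicator B (x(d := t)) \<partial>lborel) \<partial>PiM {..<d} ?L)"
    using B by (intro P.product_nn_integral_insert) (auto simp: lessThan_Suc)
  also have "\<dots> = (\<integral>\<^sup>+ x. ennreal h * indicator A x \<partial>PiM {..<d} ?L)"
  proof (rule nn_integral_cong)
    fix x assume "x \<in> space (PiM {..<d} ?L)"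
    then have "(\<integral>\<^sup>+ t. indicator B (x(d := t)) \<partial>lborel) = (\<integral>\<^sup>+ t. indicator A x * indicator {0..h} t \<partial>lborel)"
      by (intro nn_integral_cong) (simp add: mem space_PiM indicator_def)
    then show "(\<integral>\<^sup>+ t. indicator B (x(d := t)) \<partial>lborel) = ennreal h * indicator A x"
      using \<open>h > 0\<close> by (simp add: nn_integral_cmult mult.commute)
  qed
  also have "\<dots> = ennreal h * emeasure (PiM {..<d} ?L) A"
    using A by (simp add: nn_integral_cmult)
  finally have "enn2real (ennreal (measure lebesgue (slab S (h *\<^sub>R u)))) =
      enn2real (ennreal h * emeasure (PiM {..<d} ?L) A)"
    by simp
  then show ?thesis
    using \<open>h > 0\<close> by (simp add: enn2real_mult measure_def A_def d_def)
qed

text \<open>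
  If \<open>S\<close> spans its hyperplane, every frame that is admissible for \<open>flat_volume\<close> is orthogonal to
  \<open>u\<close>, so by the preceding lemma all of them give the same volume of \<open>S\<close>.
\<close>

lemma slab_measure_eq_flat_volume:
  fixes S :: "(real^'n) set"
  assumes S: "compact S" "S \<noteq> {}" and norm: "norm u = 1"
    and flat: "span {x - y | x y. x \<in> S \<and> y \<in> S} = {x. u \<bullet> x = 0}" and "h > 0"
  shows "measure lebesgue (slab S (h *\<^sub>R u)) = h * flat_volume (CARD('n) - 1) S"
proof -
  define d where "d = CARD('n) - 1"
  define H where "H = {x. u \<bullet> x = 0}"
  have "u \<noteq> 0" using norm by auto
  then have dimH: "dim H = d"
    by (simp add: H_def dim_hyperplane d_def)
  have subH: "subspace H"
    by (simp add: H_def subspace_hyperplane)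
  let ?frame = "\<lambda>a e. orthonormal_frame d e \<and> S \<subseteq> range (\<lambda>x. a + (\<Sum>j<d. x j *\<^sub>R e j))"
  let ?vol = "\<lambda>a e. measure (\<Pi>\<^sub>M j\<in>{..<d}. lborel)
           {x \<in> {..<d} \<rightarrow>\<^sub>E UNIV. a + (\<Sum>j<d. x j *\<^sub>R e j) \<in> S}"
  have vol: "measure lebesgue (slab S (h *\<^sub>R u)) = h * ?vol a e" if frame: "?frame a e" for a e
  proof -
    have "x - y \<in> span (e ` {..<d})" if xy: "x \<in> S" "y \<in> S" for x y
    proof -
      obtain p q where "x = a + (\<Sum>j<d. p j *\<^sub>R e j)" "y = a + (\<Sum>j<d. q j *\<^sub>R e j)"
        using frame xy by (meson rangeE subsetD)
      then have "x - y = (\<Sum>j<d. (p j - q j) *\<^sub>R e j)"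
        by (simp add: sum_subtractf scaleR_diff_left)
      then show ?thesis
        by (simp only:, intro span_sum span_scale span_base, blast)
    qed
    then have "H \<subseteq> span (e ` {..<d})"
      unfolding H_def flat [symmetric] by (intro span_minimal) auto
    moreover have "dim (span (e ` {..<d})) \<le> dim H"
      using card_image_le [of "{..<d}" e] dim_le_card' [of "e ` {..<d}"] by (simp add: dimH)
    ultimately have "H = span (e ` {..<d})"
      by (intro subspace_dim_equal subH subspace_span)
    then have "e j \<bullet> u = 0" if "j < d" for j
      using \<open>j < d\<close> span_base [of "e j" "e ` {..<d}"] by (auto simp: H_def inner_commute)
    then show ?thesis
      using frame \<open>h > 0\<close> norm S(1) unfolding d_def
      by (intro measure_normal_slab) auto
  qed
  have "\<exists>a e. ?frame a e"
  proof -
    obtain B where B: "B \<subseteq> H" "pairwise orthogonal B" "\<And>x. x \<in> B \<Longrightarrow> norm x = 1"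
        "independent B" "card B = d" "span B = H"
      using orthonormal_basis_subspace [OF subH] dimH by metis
    have "finite B"
      using B(4) independent_imp_finite by blast
    then obtain e where e: "bij_betw e {..<d} B"
      using ex_bij_betw_nat_finite B(5) by (metis atLeast0LessThan)
    then have inj: "e i = e j \<longleftrightarrow> i = j" if "i < d" "j < d" for i j
      using that by (auto simp: bij_betw_def inj_on_def)
    have eB: "e i \<in> B" if "i < d" for i
      using e that by (auto simp: bij_betw_def)
    have "orthonormal_frame d e"
      unfolding orthonormal_frame_def
    proof (intro allI impI)
      fix i j assume "i < d" "j < d"
      then show "e i \<bullet> e j = (if i = j then 1 else 0)"
        using B(2,3) eB inj by (auto simp: pairwise_def orthogonal_def norm_eq_1)
    qed
    moreover obtain a where "a \<in> S" using S(2) by blast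
    have "S \<subseteq> range (\<lambda>x. a + (\<Sum>j<d. x j *\<^sub>R e j))"
    proof
      fix y assume "y \<in> S"
      then have "y - a \<in> H"
        using \<open>a \<in> S\<close> unfolding H_def flat [symmetric] by (intro span_base) blast
      then have "y - a \<in> span B"
        by (simp add: B(6))
      then obtain q where "y - a = (\<Sum>b\<in>B. q b *\<^sub>R b)"
        using span_finite [OF \<open>finite B\<close>] by auto
      also have "\<dots> = (\<Sum>j<d. q (e j) *\<^sub>R e j)"
        by (rule sum.reindex_bij_betw [OF e, symmetric])
      finally have "y = a + (\<Sum>j<d. q (e j) *\<^sub>R e j)"
        by (simp add: algebra_simps)
      then show "y \<in> range (\<lambda>x. a + (\<Sum>j<d. x j *\<^sub>R e j))"
        by (auto intro: image_eqI [of _ _ "\<lambda>j. q (e j)"])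
    qed
    ultimately show ?thesis by blast
  qed
  then have "\<exists>m a e. orthonormal_frame d e \<and> S \<subseteq> range (\<lambda>x. a + (\<Sum>j<d. x j *\<^sub>R e j)) \<and> m = ?vol a e"
    by blast
  then have "\<exists>a e. orthonormal_frame d e \<and> S \<subseteq> range (\<lambda>x. a + (\<Sum>j<d. x j *\<^sub>R e j)) \<and>
      flat_volume d S = ?vol a e"
    unfolding flat_volume_def by (rule someI_ex)
  then obtain a e where frame: "?frame a e" and "flat_volume d S = ?vol a e"
    by blast
  then show ?thesis
    using vol [OF frame] by (simp add: d_def)
qed

section \<open>Affine involutions\<close>

text \<open>
  The condition \<open>a \<bullet> z = - 2\<close> makes the linear part \<open>x + (a \<bullet> x) z\<close> an oblique reflection.
\<close>

lemma measure_affine_involution_image: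
  fixes S :: "(real^'n) set"
  assumes az: "a \<bullet> z = - 2" and S: "S \<in> lmeasurable"
  shows "measure lebesgue ((\<lambda>x. x + (a \<bullet> x + b) *\<^sub>R z) ` S) = measure lebesgue S"
proof -
  let ?L = "\<lambda>x. x + (a \<bullet> x) *\<^sub>R z"
  have lin: "linear ?L"
    by (rule linearI) (simp_all add: inner_add_right algebra_simps)
  have "(\<lambda>x. x + (a \<bullet> x + b) *\<^sub>R z) ` S = (+) (b *\<^sub>R z) ` ?L ` S"
    by (simp add: image_image algebra_simps)
  then have "measure lebesgue ((\<lambda>x. x + (a \<bullet> x + b) *\<^sub>R z) ` S) = measure lebesgue (?L ` S)"
    by (simp only: measure_translation)
  also have "\<dots> = measure lebesgue S"
    by (rule measure_linear_involution_image [OF lin _ S])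
       (simp add: inner_add_right az algebra_simps)
  finally show ?thesis .
qed

section \<open>Barycentric coordinates of a simplex\<close>

text \<open>
  The barycentric coordinates are given by their gradients \<open>g i\<close> and their constant terms
  \<open>c i\<close>.
\<close>

locale barycentric =
  fixes v g :: "'n::finite option \<Rightarrow> real^'n" and c :: "'n option \<Rightarrow> real"
  assumes kronecker: "g i \<bullet> v j + c i = (if i = j then 1 else 0)"
    and sum_eq_1: "(\<Sum>i\<in>UNIV. g i \<bullet> x + c i) = 1"
    and combination: "(\<Sum>i\<in>UNIV. (g i \<bullet> x + c i) *\<^sub>R v i) = x"
begin

definition coord :: "'n option \<Rightarrow> real^'n \<Rightarrow> real" where
  "coord i x = g i \<bullet> x + c i"

lemma coord_vertex: "coord i (v j) = (if i = j then 1 else 0)"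
  by (simp add: coord_def kronecker)

lemma coord_add: "coord i (x + y) = coord i x + g i \<bullet> y"
  by (simp add: coord_def inner_add_right)

lemma sum_coord: "(\<Sum>i\<in>UNIV. coord i x) = 1"
  by (simp add: coord_def sum_eq_1)

lemma coord_combination: "(\<Sum>i\<in>UNIV. coord i x *\<^sub>R v i) = x"
  by (simp add: coord_def combination)

lemma continuous_on_coord: "continuous_on S f \<Longrightarrow> continuous_on S (\<lambda>x. coord i (f x))"
  unfolding coord_def by (intro continuous_intros)

lemma inner_gradient_edge: "g i \<bullet> (v j - v k) = (if i = j then 1 else 0) - (if i = k then 1 else 0)"
  using kronecker [of i j] kronecker [of i k] by (simp add: inner_diff_right)

lemma sum_inner_gradient: "(\<Sum>i\<in>UNIV. g i \<bullet> x) = 0"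
  using sum_eq_1 [of x] sum_eq_1 [of 0] by (simp add: sum.distrib)

lemma gradient_combination: "(\<Sum>i\<in>UNIV. (g i \<bullet> x) *\<^sub>R v i) = x"
  using combination [of x] combination [of 0] by (simp add: sum.distrib scaleR_left_distrib)

lemma other_vertex:
  fixes i :: "'n option"
  obtains j where "j \<noteq> i"
  by (metis option.distinct(1))

lemma gradient_nonzero: "g i \<noteq> 0"
proof -
  obtain j where "j \<noteq> i" by (rule other_vertex)
  then show ?thesis
    using inner_gradient_edge [of i i j] by auto
qed

text \<open>
  A translation can move the barycentric coordinates by any prescribed amounts of sum \<open>0\<close>.
\<close>

lemma inner_gradient_combination:
  assumes "sum b UNIV = 0"
  shows "g j \<bullet> (\<Sum>i\<in>UNIV. b i *\<^sub>R v i) = b j"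
proof -
  have "g j \<bullet> (\<Sum>i\<in>UNIV. b i *\<^sub>R v i) = (\<Sum>i\<in>UNIV. b i * (g j \<bullet> v i))"
    by (simp add: inner_sum_right)
  also have "\<dots> = (\<Sum>i\<in>UNIV. b i * ((if j = i then 1 else 0) - c j))"
    by (simp add: kronecker [symmetric])
  also have "\<dots> = (\<Sum>i\<in>UNIV. (if j = i then b i else 0) - b i * c j)"
    by (intro sum.cong) (auto simp: algebra_simps)
  also have "\<dots> = b j"
    using assms by (simp add: sum_subtractf sum_distrib_right [symmetric])
  finally show ?thesis .
qed

lemma convex_hull_vertices:
  "convex hull (v ` I) = {x. (\<forall>j. 0 \<le> coord j x) \<and> (\<forall>j. j \<notin> I \<longrightarrow> coord j x = 0)}" (is "_ = ?C")
proof
  have affine: "coord j (s *\<^sub>R x + t *\<^sub>R y) = s * coord j x + t * coord j y" if "s + t = 1" for s t x y j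
  proof -
    have "c j = s * c j + t * c j"
      using that by (metis distrib_right mult_1)
    then show ?thesis
      by (simp add: coord_def inner_add_right algebra_simps)
  qed
  show "convex hull (v ` I) \<subseteq> ?C"
    by (rule hull_minimal) (auto simp: coord_vertex convex_def affine)
  show "?C \<subseteq> convex hull (v ` I)"
  proof
    fix x assume x: "x \<in> ?C"
    have "(\<Sum>j\<in>I. coord j x) = 1"
      using x sum.mono_neutral_right [of UNIV I "\<lambda>j. coord j x"] sum_coord [of x] by auto
    moreover have "x = (\<Sum>j\<in>I. coord j x *\<^sub>R v j)"
      using x sum.mono_neutral_right [of UNIV I "\<lambda>j. coord j x *\<^sub>R v j"] coord_combination [of x]
      by auto
    moreover have "(\<Sum>j\<in>I. coord j x *\<^sub>R v j) \<in> convex hull (v ` I)"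
      using x \<open>(\<Sum>j\<in>I. coord j x) = 1\<close>
      by (intro convex_sum) (auto simp: hull_inc)
    ultimately show "x \<in> convex hull (v ` I)"
      by simp
  qed
qed

lemma mem_face: "x \<in> simplex_face v i \<longleftrightarrow> coord i x = 0 \<and> (\<forall>j. 0 \<le> coord j x)"
  by (auto simp: simplex_face_def convex_hull_vertices)

lemma vertex_mem_face: "j \<noteq> i \<Longrightarrow> v j \<in> simplex_face v i"
  by (simp add: mem_face coord_vertex)

lemma compact_face: "compact (simplex_face v i)"
  unfolding simplex_face_def by (intro finite_imp_compact_convex_hull) simp

lemma interior_hull: "interior (simplex_hull v) = {x. \<forall>i. 0 < coord i x}"
proof
  have hull: "simplex_hull v = {x. \<forall>i. 0 \<le> coord i x}"
    by (simp add: simplex_hull_def convex_hull_vertices)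
  show "{x. \<forall>i. 0 < coord i x} \<subseteq> interior (simplex_hull v)"
  proof (rule interior_maximal)
    have "{x. \<forall>i. 0 < coord i x} = (\<Inter>i. {x. 0 < coord i x})"
      by auto
    also have "open \<dots>"
      by (intro open_INT ballI open_Collect_less continuous_intros continuous_on_coord) simp
    finally show "open {x. \<forall>i. 0 < coord i x}" .
  qed (auto simp: hull less_imp_le)
  have "interior (simplex_hull v) \<subseteq> {x. 0 < coord i x}" for i
  proof -
    have "interior (simplex_hull v) \<subseteq> interior {x. g i \<bullet> x \<ge> - c i}"
      by (rule interior_mono) (auto simp: hull coord_def dest: spec [of _ i])
    also have "\<dots> = {x. 0 < coord i x}"
      using gradient_nonzero by (auto simp: coord_def)
    finally show ?thesis .
  qed
  then show "interior (simplex_hull v) \<subseteq> {x. \<forall>i. 0 < coord i x}"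
    by blast
qed

text \<open>
  The segment from a vertex \<open>v j\<close> of the face to a relative interior point \<open>p\<close> can be prolonged
  beyond \<open>p\<close> within the face; if \<open>coord j p\<close> were \<open>0\<close>, that coordinate would become negative.
\<close>

lemma coord_rel_interior_face:
  assumes p: "p \<in> rel_interior (simplex_face v i)"
  shows "coord i p = 0" and "j \<noteq> i \<Longrightarrow> 0 < coord j p"
proof -
  show "coord i p = 0"
    using p rel_interior_subset mem_face by blast
  assume "j \<noteq> i"
  then have vj: "v j \<in> simplex_face v i"
    by (rule vertex_mem_face)
  moreover have "convex (simplex_face v i)"
    by (simp add: simplex_face_def convex_convex_hull)
  ultimately have "\<exists>e>1. (1 - e) *\<^sub>R v j + e *\<^sub>R p \<in> simplex_face v i"
    using p convex_rel_interior_iff [of "simplex_face v i" p] by blast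
  then obtain e where "e > 1" and e: "(1 - e) *\<^sub>R v j + e *\<^sub>R p \<in> simplex_face v i"
    by blast
  have "coord j ((1 - e) *\<^sub>R v j + e *\<^sub>R p) = (1 - e) * coord j (v j) + e * coord j p"
    by (simp add: coord_def inner_add_right algebra_simps)
  moreover have "0 \<le> coord j ((1 - e) *\<^sub>R v j + e *\<^sub>R p)"
    using e mem_face by blast
  ultimately have "e - 1 \<le> e * coord j p"
    by (simp add: coord_vertex)
  then show "0 < coord j p"
    using \<open>e > 1\<close> by (smt (verit) zero_less_mult_pos)
qed

section \<open>The volumes of the faces\<close>

lemma span_face_differences:
  "span {x - y | x y. x \<in> simplex_face v i \<and> y \<in> simplex_face v i} = {x. g i \<bullet> x = 0}"
  (is "span ?D = _")
proof
  have "?D \<subseteq> {x. g i \<bullet> x = 0}"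
    by (auto simp: mem_face coord_def inner_diff_right)
  then show "span ?D \<subseteq> {x. g i \<bullet> x = 0}"
    by (rule span_minimal) (rule subspace_hyperplane)
  show "{x. g i \<bullet> x = 0} \<subseteq> span ?D"
  proof
    fix x assume x: "x \<in> {x. g i \<bullet> x = 0}"
    obtain k where k: "k \<noteq> i" by (rule other_vertex)
    have "(\<Sum>j\<in>UNIV. (g j \<bullet> x) *\<^sub>R (v j - v k)) = x"
      using gradient_combination [of x] sum_inner_gradient [of x]
      by (simp add: scaleR_diff_right sum_subtractf scaleR_sum_left [symmetric])
    moreover have "(g j \<bullet> x) *\<^sub>R (v j - v k) \<in> span ?D" for j
    proof (cases "j = i")
      case True
      with x show ?thesis by (simp add: span_zero)
    next
      case False
      with k show ?thesis
        by (intro span_scale span_base) (auto intro: vertex_mem_face)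
    qed
    ultimately show "x \<in> span ?D"
      by (metis (no_types, lifting) span_sum)
  qed
qed

text \<open>
  The reflection that fixes the hyperplane of the face and sends \<open>w\<close> to \<open>- w'\<close> maps the first slab
  to the slab in direction \<open>- w'\<close>, which is a translate of the second one.
\<close>

lemma measure_slab_face_eq:
  assumes "g i \<bullet> w = 1" "g i \<bullet> w' = 1"
  shows "measure lebesgue (slab (simplex_face v i) w) = measure lebesgue (slab (simplex_face v i) w')"
proof -
  let ?F = "simplex_face v i"
  let ?f = "\<lambda>x. x + (g i \<bullet> x + c i) *\<^sub>R (- (w + w'))"
  have f: "?f (y + t *\<^sub>R w) = y + (1 - t) *\<^sub>R w' - w'" if "y \<in> ?F" for y t
    using that assms by (simp add: mem_face coord_def inner_add_right algebra_simps)
  have "?f ` slab ?F w = (\<lambda>x. x - w') ` slab ?F w'"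
  proof (intro equalityI subsetI)
    fix x assume "x \<in> ?f ` slab ?F w"
    then obtain y t where yt: "y \<in> ?F" "0 \<le> t" "t \<le> 1" and "x = ?f (y + t *\<^sub>R w)"
      by (auto simp: slab_def)
    then have "x = y + (1 - t) *\<^sub>R w' - w'"
      using f by blast
    moreover have "y + (1 - t) *\<^sub>R w' \<in> slab ?F w'"
      using yt unfolding slab_def by (intro image_eqI [of _ _ "(y, 1 - t)"]) auto
    ultimately show "x \<in> (\<lambda>x. x - w') ` slab ?F w'"
      by blast
  next
    fix x assume "x \<in> (\<lambda>x. x - w') ` slab ?F w'"
    then obtain y t where yt: "y \<in> ?F" "0 \<le> t" "t \<le> 1" and "x = y + t *\<^sub>R w' - w'"
      by (auto simp: slab_def)
    then have "x = ?f (y + (1 - t) *\<^sub>R w)"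
      using f [of y "1 - t"] by simp
    moreover have "y + (1 - t) *\<^sub>R w \<in> slab ?F w"
      using yt unfolding slab_def by (intro image_eqI [of _ _ "(y, 1 - t)"]) auto
    ultimately show "x \<in> ?f ` slab ?F w"
      by blast
  qed
  moreover have "measure lebesgue (?f ` slab ?F w) = measure lebesgue (slab ?F w)"
    using assms by (intro measure_affine_involution_image)
       (simp_all add: inner_add_right inner_diff_right lmeasurable_compact compact_slab compact_face)
  ultimately show ?thesis
    by (simp add: measure_translation_subtract)
qed

text \<open>
  The affine map that exchanges the vertices \<open>v i\<close> and \<open>v j\<close> and fixes all others exchanges the two
  slabs.
\<close>

lemma measure_slab_face_swap:
  assumes "i \<noteq> j"
  shows "measure lebesgue (slab (simplex_face v i) (v i - v j)) =
         measure lebesgue (slab (simplex_face v j) (v j - v i))"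
proof -
  define f where "f x = x + (coord i x - coord j x) *\<^sub>R (v j - v i)" for x
  have coord_f: "coord k (f x) = coord (if k = i then j else if k = j then i else k) x" for k x
    using \<open>i \<noteq> j\<close> by (auto simp: f_def coord_add inner_gradient_edge)
  have ff: "f (f x) = x" for x
  proof -
    have "f (f x) = f x + (coord j x - coord i x) *\<^sub>R (v j - v i)"
      using \<open>i \<noteq> j\<close> by (simp add: f_def [of "f x"] coord_f)
    also have "\<dots> = x"
      by (simp add: f_def scaleR_left_distrib [symmetric] add.assoc)
    finally show ?thesis .
  qed
  have face: "f x \<in> simplex_face v j \<longleftrightarrow> x \<in> simplex_face v i" for x
  proof -
    have "(\<forall>k. 0 \<le> coord k (f x)) \<longleftrightarrow> (\<forall>k. 0 \<le> coord k x)"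
      unfolding coord_f by (metis \<open>i \<noteq> j\<close>)
    then show ?thesis
      using coord_f [of j x] \<open>i \<noteq> j\<close> by (simp add: mem_face)
  qed
  have f_slab: "f (y + t *\<^sub>R (v i - v j)) = f y + t *\<^sub>R (v j - v i)" for y t
  proof -
    have "f (y + t *\<^sub>R (v i - v j)) =
        y + t *\<^sub>R (v i - v j) + (coord i y - coord j y + (t + t)) *\<^sub>R (v j - v i)"
      using \<open>i \<noteq> j\<close> by (simp add: f_def coord_add inner_gradient_edge)
    also have "\<dots> = f y + t *\<^sub>R (v j - v i)"
      by (simp add: f_def vec_eq_iff algebra_simps)
    finally show ?thesis .
  qed
  have "f ` slab (simplex_face v i) (v i - v j) = slab (simplex_face v j) (v j - v i)"
  proof (intro equalityI subsetI)
    fix x assume "x \<in> f ` slab (simplex_face v i) (v i - v j)"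
    then obtain y t where yt: "y \<in> simplex_face v i" "0 \<le> t" "t \<le> 1"
        and "x = f (y + t *\<^sub>R (v i - v j))"
      by (auto simp: slab_def)
    then show "x \<in> slab (simplex_face v j) (v j - v i)"
      unfolding slab_def f_slab by (intro image_eqI [of _ _ "(f y, t)"]) (simp_all add: face)
  next
    fix x assume "x \<in> slab (simplex_face v j) (v j - v i)"
    then obtain y t where yt: "y \<in> simplex_face v j" "0 \<le> t" "t \<le> 1"
        and x: "x = y + t *\<^sub>R (v j - v i)"
      by (auto simp: slab_def)
    then have "f y \<in> simplex_face v i"
      using face [of "f y"] ff by simp
    then have "f y + t *\<^sub>R (v i - v j) \<in> slab (simplex_face v i) (v i - v j)"
      using yt unfolding slab_def by (intro image_eqI [of _ _ "(f y, t)"]) auto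
    moreover have "x = f (f y + t *\<^sub>R (v i - v j))"
      unfolding f_slab ff x ..
    ultimately show "x \<in> f ` slab (simplex_face v i) (v i - v j)"
      by blast
  qed
  moreover have "measure lebesgue (f ` slab (simplex_face v i) (v i - v j)) =
      measure lebesgue (slab (simplex_face v i) (v i - v j))"
  proof -
    have "f = (\<lambda>x. x + ((g i - g j) \<bullet> x + (c i - c j)) *\<^sub>R (v j - v i))"
      by (simp add: fun_eq_iff f_def coord_def inner_diff_left algebra_simps)
    moreover have "(g i - g j) \<bullet> (v j - v i) = - 2"
      using \<open>i \<noteq> j\<close> by (simp add: inner_diff_left inner_gradient_edge)
    ultimately show ?thesis
      by (simp only: measure_affine_involution_image lmeasurable_compact compact_slab compact_face)
  qed
  ultimately show ?thesis
    by simp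
qed

text \<open>
  The vector \<open>w i\<close> in the proof is the normal vector of the face along which \<open>coord i\<close> increases
  by \<open>1\<close>; the factor \<open>V\<close> is the volume of the slab over the face with this height.
\<close>

lemma flat_volume_face_proportional:
  "\<exists>V. \<forall>i. flat_volume (CARD('n) - 1) (simplex_face v i) = V * norm (g i)"
proof -
  define w where "w i = (1 / norm (g i)) *\<^sub>R ((1 / norm (g i)) *\<^sub>R g i)" for i
  define V where "V i = measure lebesgue (slab (simplex_face v i) (w i))" for i
  have gw: "g i \<bullet> w i = 1" for i
    using gradient_nonzero [of i] by (simp add: w_def dot_square_norm power2_eq_square)
  have vol: "flat_volume (CARD('n) - 1) (simplex_face v i) = V i * norm (g i)" for i
  proof -
    obtain j where "j \<noteq> i" by (rule other_vertex)
    have "V i = (1 / norm (g i)) * flat_volume (CARD('n) - 1) (simplex_face v i)"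
      unfolding V_def w_def
    proof (rule slab_measure_eq_flat_volume)
      show "simplex_face v i \<noteq> {}"
        using vertex_mem_face [OF \<open>j \<noteq> i\<close>] by blast
      show "span {x - y |x y. x \<in> simplex_face v i \<and> y \<in> simplex_face v i} =
          {x. (1 / norm (g i)) *\<^sub>R g i \<bullet> x = 0}"
        using gradient_nonzero [of i] by (simp add: span_face_differences)
    qed (use gradient_nonzero [of i] in \<open>simp_all add: compact_face\<close>)
    then show ?thesis
      using gradient_nonzero [of i] by simp
  qed
  have "V i = V j" if "i \<noteq> j" for i j
  proof -
    have "V i = measure lebesgue (slab (simplex_face v i) (v i - v j))"
      unfolding V_def using that gw by (intro measure_slab_face_eq) (simp_all add: inner_gradient_edge)
    also have "\<dots> = measure lebesgue (slab (simplex_face v j) (v j - v i))"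
      by (rule measure_slab_face_swap [OF that])
    also have "\<dots> = V j"
      unfolding V_def using that gw by (intro measure_slab_face_eq) (simp_all add: inner_gradient_edge)
    finally show ?thesis .
  qed
  then have "V i = V None" for i
    by metis
  with vol show ?thesis
    by metis
qed

text \<open>
  Being orthogonal to the face, the normal is a multiple of the gradient; \<open>outward_face_normal\<close>
  determines the sign of the factor, and the norm of the normal its absolute value.
\<close>

lemma outward_normals_eq_gradients:
  assumes normal: "\<And>i. outward_face_normal v i (k i)"
  shows "\<exists>V>0. \<forall>i. k i = - V *\<^sub>R g i"
proof -
  obtain V where V: "\<And>i. flat_volume (CARD('n) - 1) (simplex_face v i) = V * norm (g i)"
    using flat_volume_face_proportional by blast
  have "V > 0 \<and> k i = - V *\<^sub>R g i" for i
  proof -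
    obtain j where j: "j \<noteq> i" by (rule other_vertex)
    define \<beta> where "\<beta> = - (k i \<bullet> (v i - v j))"
    have "k i \<bullet> x = (- \<beta> *\<^sub>R g i) \<bullet> x" for x
    proof -
      have "x = (\<Sum>l\<in>UNIV. (g l \<bullet> x) *\<^sub>R (v l - v j))"
        using gradient_combination [of x] sum_inner_gradient [of x]
        by (simp add: scaleR_diff_right sum_subtractf scaleR_sum_left [symmetric])
      then have "k i \<bullet> x = (\<Sum>l\<in>UNIV. (g l \<bullet> x) * (k i \<bullet> (v l - v j)))"
        by (metis (no_types, lifting) inner_scaleR_right inner_sum_right sum.cong)
      also have "\<dots> = (\<Sum>l\<in>UNIV. if l = i then (g i \<bullet> x) * (k i \<bullet> (v i - v j)) else 0)"
        using normal [of i] j by (intro sum.cong) (auto simp: outward_face_normal_def vertex_mem_face)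
      finally show ?thesis
        by (simp add: \<beta>_def)
    qed
    then have k_eq: "k i = - \<beta> *\<^sub>R g i"
      by (metis vector_eq_rdot)
    have "\<beta> > 0"
      using normal [of i] vertex_mem_face [OF j] by (simp add: outward_face_normal_def \<beta>_def)
    then have "\<beta> * norm (g i) = V * norm (g i)"
      using normal [of i] V [of i] by (simp add: outward_face_normal_def k_eq)
    with gradient_nonzero [of i] have "\<beta> = V"
      by simp
    with \<open>\<beta> > 0\<close> k_eq show ?thesis
      by simp
  qed
  then show ?thesis
    by blast
qed

section \<open>Immobilization\<close>

text \<open>
  The translation \<open>a\<close> drops out because the gradients have sum \<open>0\<close>.
\<close>

lemma contact_Phi_eq_sum_coord:
  assumes k: "\<And>i. k i = - V *\<^sub>R g i" and p: "\<And>i. coord i (p i) = 0"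
  shows "contact_Phi p k r = - V * (\<Sum>i\<in>UNIV. coord i (r *v p i + a))"
proof -
  have "coord i (r *v p i + a) = g i \<bullet> (r *v p i - p i) + g i \<bullet> a" for i
    using p [of i] by (simp add: coord_def inner_add_right inner_diff_right)
  then have "(\<Sum>i\<in>UNIV. coord i (r *v p i + a)) = (\<Sum>i\<in>UNIV. g i \<bullet> (r *v p i - p i))"
    by (simp add: sum.distrib sum_inner_gradient)
  then show ?thesis
    by (simp add: contact_Phi_def k sum_distrib_left inner_commute)
qed

end

text \<open>
  The edge vectors at \<open>v None\<close> form the columns of an invertible matrix; the rows of its inverse are
  the gradients of the coordinates other than the one of \<open>v None\<close>.
\<close>

lemma ex_barycentric:
  fixes v :: "'n::finite option \<Rightarrow> real^'n"
  assumes "simplex_volume v > 0"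
  obtains g c where "barycentric v g c"
proof -
  define A :: "real^'n^'n" where "A = (\<chi> r c. (v (Some c) - v None) $ r)"
  have "invertible A"
    using assms by (auto simp: invertible_det_nz simplex_volume_def A_def)
  then obtain B where AB: "A ** B = mat 1" and BA: "B ** A = mat 1"
    by (auto simp: invertible_def)
  define b where "b x = B *v (x - v None)" for x
  define g where "g i = (case i of None \<Rightarrow> - (\<Sum>j\<in>UNIV. B $ j) | Some j \<Rightarrow> B $ j)" for i
  define c where "c i = (case i of None \<Rightarrow> 1 + (\<Sum>j\<in>UNIV. B $ j \<bullet> v None) | Some j \<Rightarrow> - (B $ j \<bullet> v None))" for i
  have Some: "g (Some j) \<bullet> x + c (Some j) = b x $ j" for j x
    by (simp add: g_def c_def b_def matrix_vector_mul_component inner_diff_right)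
  have None: "g None \<bullet> x + c None = 1 - (\<Sum>j\<in>UNIV. b x $ j)" for x
    by (simp add: g_def c_def b_def matrix_vector_mul_component inner_diff_right inner_sum_left sum_subtractf)
  have b_None: "b (v None) = 0"
    by (simp add: b_def)
  have b_Some: "b (v (Some j)) $ i = (if i = j then 1 else 0)" for i j
  proof -
    have "b (v (Some j)) $ i = (B ** A) $ i $ j"
      by (simp add: b_def matrix_vector_mult_def matrix_matrix_mult_def A_def)
    then show ?thesis
      by (simp add: BA mat_def)
  qed
  have split: "(\<Sum>i\<in>UNIV. f i) = f None + (\<Sum>j\<in>UNIV. f (Some j))"
    for f :: "'n option \<Rightarrow> 'b::comm_monoid_add"
    by (simp add: UNIV_option_conv sum.reindex)
  have "barycentric v g c"
  proof
    show "g i \<bullet> v j + c i = (if i = j then 1 else 0)" for i j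
      by (cases i; cases j) (simp_all add: Some None b_None b_Some)
    show "(\<Sum>i\<in>UNIV. g i \<bullet> x + c i) = 1" for x
      by (simp add: split Some None)
    have Ab: "(\<Sum>j\<in>UNIV. b x $ j *\<^sub>R (v (Some j) - v None)) = x - v None" for x
    proof -
      have "(\<Sum>j\<in>UNIV. b x $ j *\<^sub>R (v (Some j) - v None)) = A *v b x"
        by (simp add: vec_eq_iff matrix_vector_mult_def A_def mult.commute)
      also have "\<dots> = x - v None"
        by (simp add: b_def matrix_vector_mul_assoc AB)
      finally show ?thesis .
    qed
    show "(\<Sum>i\<in>UNIV. (g i \<bullet> x + c i) *\<^sub>R v i) = x" for x
    proof -
      have "(\<Sum>i\<in>UNIV. (g i \<bullet> x + c i) *\<^sub>R v i) =
          (1 - (\<Sum>j\<in>UNIV. b x $ j)) *\<^sub>R v None + (\<Sum>j\<in>UNIV. b x $ j *\<^sub>R v (Some j))"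
        by (simp only: split Some None)
      also have "\<dots> = v None + (\<Sum>j\<in>UNIV. b x $ j *\<^sub>R (v (Some j) - v None))"
        by (simp add: scaleR_diff_left scaleR_diff_right sum_subtractf scaleR_sum_left)
      finally show ?thesis
        by (simp add: Ab)
    qed
  qed
  then show thesis
    by (rule that)
qed

theorem proposition8:
  fixes v p k :: "'n::finite option \<Rightarrow> real^'n"
  assumes "simplex_volume v > 0"
    and "\<forall>i. outward_face_normal v i (k i)"
    and "\<forall>i. p i \<in> rel_interior (simplex_face v i)"
  shows "immobilizes p v \<longleftrightarrow> strict_local_max_on SO (contact_Phi p k) (mat 1)"
proof -
  obtain g c where "barycentric v g c"
    using ex_barycentric assms(1) by blast
  then interpret barycentric v g c .
  obtain V where "V > 0" and k: "\<And>i. k i = - V *\<^sub>R g i"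
    using outward_normals_eq_gradients assms(2) by blast
  have coord_p: "coord i (p i) = 0" and coord_p_pos: "j \<noteq> i \<Longrightarrow> 0 < coord j (p i)" for i j
    using assms(3) coord_rel_interior_face by blast+
  note Phi = contact_Phi_eq_sum_coord [of k V p, OF k coord_p]
  have Phi_id: "contact_Phi p k (mat 1) = 0"
    by (simp add: contact_Phi_def)
  have id_SO: "mat 1 \<in> (SO :: (real^'n^'n) set)"
    by (simp add: SO_def rotation_matrix_def orthogonal_matrix_id)
  have cont_mult: "continuous_on X (\<lambda>g. f g *v (x :: real^'n))"
    if "continuous_on X f" for X :: "'b::topological_space set" and f :: "'b \<Rightarrow> real^'n^'n" and x
    using that unfolding matrix_vector_mult_def
    by (intro continuous_on_vec_lambda continuous_intros)
  show ?thesis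
  proof
    assume "strict_local_max_on SO (contact_Phi p k) (mat 1)"
    then obtain U where U: "openin (top_of_set SO) U" "mat 1 \<in> U"
      and max: "\<And>r. r \<in> U \<Longrightarrow> r \<noteq> mat 1 \<Longrightarrow> contact_Phi p k r < 0"
      unfolding strict_local_max_on_def Phi_id by blast
    \<comment> \<open>On \<open>W\<close>, only the coordinate of its own face can keep a moved contact point out of the
        interior.\<close>
    define W where "W = (\<Inter>i. \<Inter>j\<in>-{i}. {h. 0 < coord j (rigid_apply h (p i))})"
    define N where "N = (rigid_motions \<inter> fst -` U) \<inter> (rigid_motions \<inter> W)"
    have "open W"
      unfolding W_def rigid_apply_def
      by (intro open_INT ballI open_Collect_less continuous_intros continuous_on_coord cont_mult) auto
    then have "openin (top_of_set rigid_motions) N"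
      unfolding N_def
      by (intro openin_Int openin_open_Int continuous_openin_preimage [OF _ _ U(1)] continuous_intros)
         (auto simp: rigid_motions_def)
    moreover have "rigid_id \<in> N"
      using U(2) id_SO coord_p_pos
      by (auto simp: N_def W_def rigid_id_def rigid_motions_def rigid_apply_def)
    moreover have "\<exists>i. rigid_apply h (p i) \<in> interior (simplex_hull v)"
      if "h \<in> N" "h \<noteq> rigid_id" for h
    proof -
      obtain r a where h: "h = (r, a)" by (cases h)
      have "\<exists>i. 0 < coord i (r *v p i + a)"
      proof (rule ccontr)
        assume "\<nexists>i. 0 < coord i (r *v p i + a)"
        then have le: "coord i (r *v p i + a) \<le> 0" for i
          by (simp add: not_less)
        then have "contact_Phi p k r \<ge> 0"
          unfolding Phi [of r a] using \<open>V > 0\<close> by (simp add: mult_nonneg_nonpos sum_nonpos)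
        then have r: "r = mat 1"
          using max [of r] \<open>h \<in> N\<close> by (force simp: N_def h)
        then have "(\<Sum>i\<in>UNIV. coord i (r *v p i + a)) = 0"
          using Phi [of r a] Phi_id \<open>V > 0\<close> by simp
        then have zero: "coord i (r *v p i + a) = 0" for i
          using le sum_nonneg_eq_0_iff [of UNIV "\<lambda>i. - coord i (r *v p i + a)"]
          by (simp add: sum_negf)
        then have "g i \<bullet> a = 0" for i
          using zero [of i] coord_p [of i] by (simp add: r coord_add)
        then have "a = 0"
          using gradient_combination [of a] by simp
        with r h \<open>h \<noteq> rigid_id\<close> show False
          by (simp add: rigid_id_def)
      qed
      then obtain i where i: "0 < coord i (r *v p i + a)" ..
      have "0 < coord j (r *v p i + a)" for j
        using i \<open>h \<in> N\<close> by (cases "j = i") (auto simp: N_def W_def h rigid_apply_def)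
      then show ?thesis
        by (auto simp: interior_hull h rigid_apply_def)
    qed
    ultimately show "immobilizes p v"
      unfolding immobilizes_def by blast
  next
    assume "immobilizes p v"
    then obtain N where N: "openin (top_of_set rigid_motions) N" "rigid_id \<in> N"
      and imm: "\<And>h. h \<in> N \<Longrightarrow> h \<noteq> rigid_id \<Longrightarrow> \<exists>i. rigid_apply h (p i) \<in> interior (simplex_hull v)"
      unfolding immobilizes_def by blast
    \<comment> \<open>The translation \<open>t r\<close> equalizes the coordinates \<open>coord i (r *v p i + t r)\<close>: all of them become
        the mean \<open>m r\<close>.  It depends continuously on \<open>r\<close> and vanishes at the identity.\<close>
    define S where "S r = (\<Sum>i\<in>UNIV. coord i (r *v p i))" for r
    define m where "m r = S r / CARD('n option)" for r
    define t where "t r = (\<Sum>i\<in>UNIV. (m r - coord i (r *v p i)) *\<^sub>R v i)" for r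
    have coord_t: "coord i (r *v p i + t r) = m r" for i r
    proof -
      have "(\<Sum>i\<in>UNIV. m r - coord i (r *v p i)) = 0"
        by (simp add: sum_subtractf m_def S_def)
      then show ?thesis
        unfolding coord_add t_def by (simp add: inner_gradient_combination)
    qed
    define U where "U = SO \<inter> (\<lambda>r. (r, t r)) -` N"
    have "continuous_on SO (\<lambda>r. (r, t r))"
      unfolding t_def m_def S_def
      by (intro continuous_intros continuous_on_coord cont_mult) auto
    then have "openin (top_of_set SO) U"
      unfolding U_def by (rule continuous_openin_preimage [OF _ _ N(1)]) (auto simp: rigid_motions_def)
    moreover have "mat 1 \<in> U"
    proof -
      have "t (mat 1) = 0"
        by (simp add: t_def m_def S_def coord_p)
      then show ?thesis
        using N(2) id_SO by (simp add: U_def rigid_id_def)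
    qed
    moreover have "contact_Phi p k r < contact_Phi p k (mat 1)" if "r \<in> U" "r \<noteq> mat 1" for r
    proof -
      have "(r, t r) \<in> N" "(r, t r) \<noteq> rigid_id"
        using that by (auto simp: U_def rigid_id_def)
      then obtain i where "rigid_apply (r, t r) (p i) \<in> interior (simplex_hull v)"
        using imm by blast
      then have "0 < coord i (r *v p i + t r)"
        by (simp add: interior_hull rigid_apply_def)
      then have "0 < S r"
        by (simp add: coord_t m_def zero_less_divide_iff)
      moreover have "contact_Phi p k r = - V * S r"
        using Phi [of r 0] by (simp add: S_def)
      ultimately show ?thesis
        using \<open>V > 0\<close> by (simp add: Phi_id)
    qed
    ultimately show "strict_local_max_on SO (contact_Phi p k) (mat 1)"
      unfolding strict_local_max_on_def by blast
  qed
qed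

end
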